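(* Let $H$ be a Hilbert space, let $(\Omega,\mu)$ be a measure space with positive measure $\mu$, let $F,G:\Omega\to H$ be such that $(F,F)$ and $(G,G)$ are continuous biframe Bessel mappings for $H$ with respect to $(\Omega,\mu)$, and let $m:\Omega\to\mathbb{C}$ be an essentially bounded measurable function. Suppose that the continuous biframe Bessel multiplier $M_{m,F,G}$ is invertible and that $(F,G)$ is a continuous biframe for $H$ with respect to $(\Omega,\mu)$. Then the pair $$\Bigl(\bigl(M_{m,F,G}^{-1}\bigr)^{*}\,\overline{m}F,\;G\Bigr)$$ is a dual continuous biframe for $H$, where $\bigl(M_{m,F,G}^{-1}\bigr)^{*}\,\overline{m}F$ denotes the mapping $w\mapsto\bigl(M_{m,F,G}^{-1}\bigr)^{*}\bigl(\overline{m(w)}\,F(w)\bigr)$.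
   Context: Inner products are linear in the first variable. A pair $(F,G)$ of mappings $F,G:\Omega\to H$ is called a continuous biframe for $H$ with respect to $(\Omega,\mu)$ if (i) for every $f\in H$ the functions $w\mapsto\langle f,F(w)\rangle$ and $w\mapsto\langle f,G(w)\rangle$ are measurable on $\Omega$; and (ii) there exist constants $0<A\le B<\infty$ such that for all $f\in H$ $$A\|f\|^2\le\int_\Omega\langle f,F(w)\rangle\langle G(w),f\rangle\,d\mu\le B\|f\|^2.$$ If (i) holds and only the right-hand inequality in (ii) is required (for some $0<B<\infty$), $(F,G)$ is called a continuous biframe Bessel mapping with bound $B$. When $(F,F)$ and $(G,G)$ are continuous biframe Bessel mappings, the continuous biframe Bessel multiplier of $F$ and $G$ with respect to $m$ is the bounded linear operator $M_{m,F,G}:H\to H$ defined by $$\langle M_{m,F,G}f,g\rangle=\int_\Omega m(w)\langle f,F(w)\rangle\langle G(w),g\rangle\,d\mu\qquad(f,g\in H).$$ A continuous biframe $(F,G)$ for $H$ is called a dual continuous biframe for $H$ if $\langle f,g\rangle=\int_\Omega\langle f,F(w)\rangle\langle G(w),g\rangle\,d\mu$ for all $f,g\in H$. *)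

theory Defs
  imports "HOL-Analysis.Analysis"
begin

text \<open>
  A complex inner product space is a real inner product space (so that norm, topology and
  completeness are those of the library) with a compatible complex scalar multiplication and a
  complex inner product, linear in the first variable, whose real part is the real inner product.
\<close>

class complex_inner = real_inner +
  fixes scaleC :: "complex \<Rightarrow> 'a \<Rightarrow> 'a"  (infixr \<open>*\<^sub>C\<close> 75)
    and cinner :: "'a \<Rightarrow> 'a \<Rightarrow> complex"
  assumes scaleC_add_right: "c *\<^sub>C (x + y) = c *\<^sub>C x + c *\<^sub>C y"
    and scaleC_add_left: "(c + d) *\<^sub>C x = c *\<^sub>C x + d *\<^sub>C x"
    and scaleC_scaleC: "c *\<^sub>C (d *\<^sub>C x) = (c * d) *\<^sub>C x"
    and scaleR_eq_scaleC: "r *\<^sub>R x = complex_of_real r *\<^sub>C x"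
    and cinner_commute: "cinner x y = cnj (cinner y x)"
    and cinner_add_left: "cinner (x + y) z = cinner x z + cinner y z"
    and cinner_scaleC_left: "cinner (c *\<^sub>C x) y = c * cinner x y"
    and inner_eq_Re_cinner: "inner x y = Re (cinner x y)"

class chilbert_space = complex_inner + complete_space

instantiation complex :: chilbert_space
begin

definition scaleC_complex_def: "scaleC c (x::complex) = c * x"
definition cinner_complex_def: "cinner (x::complex) y = x * cnj y"

instance
  by standard
    (simp_all add: scaleC_complex_def cinner_complex_def algebra_simps scaleR_conv_of_real
      inner_complex_def)

end

definition bounded_clinear :: "('a::complex_inner \<Rightarrow> 'a) \<Rightarrow> bool" where
  "bounded_clinear T \<longleftrightarrow> bounded_linear T \<and> (\<forall>c x. T (c *\<^sub>C x) = c *\<^sub>C T x)"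

definition invertible_operator :: "('a::complex_inner \<Rightarrow> 'a) \<Rightarrow> bool" where
  "invertible_operator T \<longleftrightarrow> (\<exists>S. bounded_clinear S \<and> S \<circ> T = id \<and> T \<circ> S = id)"

text \<open>
  For bounded complex-linear T, and for the multiplier below when F and G are Bessel and m is
  measurable and essentially bounded, the described operator exists and is unique by the Riesz
  representation theorem.
\<close>

definition cadjoint :: "('a::chilbert_space \<Rightarrow> 'a) \<Rightarrow> ('a \<Rightarrow> 'a)" where
  "cadjoint T = (THE S. bounded_clinear S \<and> (\<forall>x y. cinner (T x) y = cinner x (S y)))"

definition weakly_measurable_map :: "'w measure \<Rightarrow> ('w \<Rightarrow> 'h::chilbert_space) \<Rightarrow> bool" where
  "weakly_measurable_map \<mu> F \<longleftrightarrow> (\<forall>f. (\<lambda>w. cinner f (F w)) \<in> borel_measurable \<mu>)"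

text \<open>
  The biframe integrals are complex-valued in general, so an inequality between such an integral
  and a real number includes the assertion that the integral is real. Integrability is stated
  explicitly because the Bochner integral of a non-integrable function is 0 by convention; without
  it a non-integrable integrand would satisfy any upper bound.
\<close>

definition continuous_biframe ::
  "'w measure \<Rightarrow> ('w \<Rightarrow> 'h::chilbert_space) \<Rightarrow> ('w \<Rightarrow> 'h) \<Rightarrow> bool" where
  "continuous_biframe \<mu> F G \<longleftrightarrow>
     weakly_measurable_map \<mu> F \<and> weakly_measurable_map \<mu> G \<and>
     (\<exists>A B. 0 < A \<and> A \<le> B \<and>
       (\<forall>f. integrable \<mu> (\<lambda>w. cinner f (F w) * cinner (G w) f) \<and>
            (LINT w|\<mu>. cinner f (F w) * cinner (G w) f) \<in> \<real> \<and>
            A * (norm f)\<^sup>2 \<le> Re (LINT w|\<mu>. cinner f (F w) * cinner (G w) f) \<and>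
            Re (LINT w|\<mu>. cinner f (F w) * cinner (G w) f) \<le> B * (norm f)\<^sup>2))"

definition continuous_biframe_bessel ::
  "'w measure \<Rightarrow> ('w \<Rightarrow> 'h::chilbert_space) \<Rightarrow> ('w \<Rightarrow> 'h) \<Rightarrow> bool" where
  "continuous_biframe_bessel \<mu> F G \<longleftrightarrow>
     weakly_measurable_map \<mu> F \<and> weakly_measurable_map \<mu> G \<and>
     (\<exists>B>0.
       \<forall>f. integrable \<mu> (\<lambda>w. cinner f (F w) * cinner (G w) f) \<and>
           (LINT w|\<mu>. cinner f (F w) * cinner (G w) f) \<in> \<real> \<and>
           Re (LINT w|\<mu>. cinner f (F w) * cinner (G w) f) \<le> B * (norm f)\<^sup>2)"

definition essentially_bounded :: "'w measure \<Rightarrow> ('w \<Rightarrow> complex) \<Rightarrow> bool" where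
  "essentially_bounded \<mu> m \<longleftrightarrow> (\<exists>C. AE w in \<mu>. norm (m w) \<le> C)"

definition biframe_bessel_multiplier ::
  "'w measure \<Rightarrow> ('w \<Rightarrow> complex) \<Rightarrow> ('w \<Rightarrow> 'h::chilbert_space) \<Rightarrow> ('w \<Rightarrow> 'h) \<Rightarrow> ('h \<Rightarrow> 'h)" where
  "biframe_bessel_multiplier \<mu> m F G =
     (THE M. bounded_clinear M \<and>
       (\<forall>f g. cinner (M f) g = (LINT w|\<mu>. m w * cinner f (F w) * cinner (G w) g)))"

definition dual_continuous_biframe ::
  "'w measure \<Rightarrow> ('w \<Rightarrow> 'h::chilbert_space) \<Rightarrow> ('w \<Rightarrow> 'h) \<Rightarrow> bool" where
  "dual_continuous_biframe \<mu> F G \<longleftrightarrow>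
     continuous_biframe \<mu> F G \<and>
     (\<forall>f g. has_bochner_integral \<mu> (\<lambda>w. cinner f (F w) * cinner (G w) g) (cinner f g))"

end

theory Submission
  imports Defs
begin

text \<open>
  Write \<open>M\<close> for the multiplier and \<open>\<Phi> w\<close> for the image of \<open>cnj (m w) *\<^sub>C F w\<close> under the adjoint of
  \<open>inv M\<close>. Moving the adjoint and the scalar across the inner product gives
  \<open>cinner f (\<Phi> w) = m w * cinner (inv M f) (F w)\<close>. The integral that should reproduce \<open>cinner f g\<close>
  is therefore the weak integral defining \<open>cinner (M (inv M f)) g\<close>, and \<open>M (inv M f) = f\<close>.
  On the diagonal this reproducing formula gives \<open>(norm f)\<^sup>2\<close>, so the pair is a biframe with both
  bounds equal to 1.

  The computation relies on \<open>M\<close> and the adjoint satisfying their defining identities. Both are given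
  by definite descriptions, so the operators have to be shown to exist and to be unique. Both cases
  are instances of \<open>sesquilinear_operator\<close>: a bounded sesquilinear form on a Hilbert space
  is \<open>cinner (T x) y\<close> for exactly one bounded operator \<open>T\<close>. This follows from the Riesz
  representation theorem (\<open>riesz_real\<close>), applied to the real part of the form in its second argument.
  For the multiplier, the form is bounded because \<open>m\<close> is essentially bounded and the
  coefficients of \<open>f\<close> with respect to \<open>F\<close> and of \<open>g\<close> with respect to \<open>G\<close> are square integrable
  (\<open>bessel_square_integrable\<close>, \<open>multiplier_form\<close>).
\<close>

section \<open>Riesz representation over the reals\<close>

text \<open>
  The representing vector is the minimiser \<open>y\<close> of \<open>q x = (norm x)\<^sup>2 - 2 * \<phi> x\<close>. The parallelogram law
  makes every minimising sequence Cauchy, so completeness supplies \<open>y\<close>; the representation is the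
  vanishing of the derivative of \<open>q\<close> at \<open>y\<close> in each direction.
\<close>

lemma riesz_real:
  fixes \<phi> :: "'a::{real_inner,complete_space} \<Rightarrow> real"
  assumes "bounded_linear \<phi>"
  obtains y where "\<And>x. \<phi> x = inner y x"
proof -
  interpret bounded_linear \<phi> by fact
  obtain K where K: "\<And>x. norm (\<phi> x) \<le> norm x * K" using bounded by blast
  define q where "q x = (norm x)\<^sup>2 - 2 * \<phi> x" for x
  have lower: "q x \<ge> - K\<^sup>2" for x
  proof -
    have "0 \<le> (norm x - K)\<^sup>2" by simp
    moreover have "\<phi> x \<le> norm x * K" using K[of x] by simp
    ultimately show ?thesis unfolding q_def by (simp add: power2_diff)
  qed
  define I where "I = Inf (range q)"
  have bdd: "bdd_below (range q)" using lower by (auto intro!: bdd_belowI)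
  have I_le: "I \<le> q x" for x unfolding I_def by (rule cInf_lower[OF _ bdd]) simp
  have "\<exists>x. q x < I + 1 / real (Suc n)" for n
    using cInf_lessD[of "range q" "I + 1 / real (Suc n)"] by (auto simp: I_def)
  then obtain X where X: "\<And>n. q (X n) < I + 1 / real (Suc n)" by metis
  \<comment> \<open>the parallelogram law, with \<open>q\<close> at the midpoint bounded below by its infimum\<close>
  have gap: "(norm (x - z))\<^sup>2 \<le> 2 * (q x - I) + 2 * (q z - I)" for x z
  proof -
    define p where "p = (1/2) *\<^sub>R (x + z)"
    have "(norm (x - z))\<^sup>2 = 2 * q x + 2 * q z - 4 * q p"
      unfolding q_def p_def
      by (simp add: power2_norm_eq_inner inner_simps scaleR add inner_commute algebra_simps)
    moreover have "I \<le> q p" by (rule I_le)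
    ultimately show ?thesis by argo
  qed
  have "Cauchy X"
  proof (rule metric_CauchyI)
    fix e :: real assume "e > 0"
    then obtain N where N: "4 / e\<^sup>2 < real N" using reals_Archimedean2 by blast
    have "dist (X i) (X j) < e" if "i \<ge> N" "j \<ge> N" for i j
    proof -
      have small: "q (X k) - I < e\<^sup>2 / 4" if "k \<ge> N" for k
      proof -
        have "4 / e\<^sup>2 < real (Suc k)" using N that by linarith
        then have "1 / real (Suc k) < e\<^sup>2 / 4" using \<open>e > 0\<close> by (simp add: field_simps)
        with X[of k] show ?thesis by linarith
      qed
      have "(norm (X i - X j))\<^sup>2 < e\<^sup>2"
        using gap[of "X i" "X j"] small[OF that(1)] small[OF that(2)] by argo
      then show ?thesis using \<open>e > 0\<close> by (simp add: dist_norm power2_less_imp_less)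
    qed
    then show "\<exists>M. \<forall>m\<ge>M. \<forall>n\<ge>M. dist (X m) (X n) < e" by blast
  qed
  then obtain y where y: "X \<longlonglongrightarrow> y" using Cauchy_convergent convergent_def by blast
  have "(\<lambda>n. q (X n)) \<longlonglongrightarrow> q y"
    unfolding q_def by (intro tendsto_intros tendsto y)
  moreover have "(\<lambda>n. I + 1 / real (Suc n)) \<longlonglongrightarrow> I + 0"
    using LIMSEQ_inverse_real_of_nat by (intro tendsto_intros) (simp add: inverse_eq_divide)
  ultimately have "q y \<le> I + 0"
    by (rule LIMSEQ_le) (use X in \<open>auto intro: less_imp_le\<close>)
  then have min: "q y \<le> q x" for x using I_le[of x] by simp
  have "\<phi> h = inner y h" for h
  proof -
    define c where "c = inner y h - \<phi> h"
    define n where "n = (norm h)\<^sup>2"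
    \<comment> \<open>a step against the slope \<open>2 * c\<close>, short enough for the linear term to dominate;
      \<open>n + 1\<close> instead of \<open>n\<close> also covers \<open>h = 0\<close>\<close>
    define t where "t = - c / (n + 1)"
    have n: "n \<ge> 0" by (simp add: n_def)
    have "q (y + t *\<^sub>R h) - q y = 2 * t * c + t\<^sup>2 * n"
      unfolding q_def c_def n_def power2_norm_eq_inner
      by (simp add: inner_simps scaleR add inner_commute algebra_simps
          power2_eq_square)
    with min[of "y + t *\<^sub>R h"] have "0 \<le> 2 * t * c + t\<^sup>2 * n" by simp
    moreover have "2 * t * c + t\<^sup>2 * n = - (c / (n + 1))\<^sup>2 * (n + 2)"
      using n unfolding t_def by (simp add: divide_simps) (simp add: power2_eq_square algebra_simps)
    ultimately have "(c / (n + 1))\<^sup>2 * (n + 2) \<le> 0" by simp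
    then have "c = 0" using n by (simp add: mult_le_0_iff)
    then show ?thesis by (simp add: c_def)
  qed
  then show thesis by (rule that)
qed

section \<open>Complex inner products\<close>

lemma cinner_add_right: "cinner x (y + z) = cinner x y + cinner x z"
  by (metis cinner_add_left cinner_commute complex_cnj_add)

lemma cinner_scaleC_right: "cinner x (c *\<^sub>C y) = cnj c * cinner x y"
  by (metis cinner_commute cinner_scaleC_left complex_cnj_mult)

lemma cinner_self: "cinner x x = complex_of_real ((norm x)\<^sup>2)"
proof (rule complex_eqI)
  show "Im (cinner x x) = Im (complex_of_real ((norm x)\<^sup>2))"
    using cinner_commute[of x x] by (simp add: complex_eq_iff)
qed (simp add: power2_norm_eq_inner inner_eq_Re_cinner)

lemma norm_scaleC: "norm (c *\<^sub>C x) = norm c * norm (x::'a::complex_inner)"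
proof -
  have "complex_of_real ((norm (c *\<^sub>C x))\<^sup>2) = (c * cnj c) * cinner x x"
    by (simp only: cinner_self[symmetric] cinner_scaleC_left cinner_scaleC_right ac_simps)
  also have "\<dots> = complex_of_real ((norm c * norm x)\<^sup>2)"
    by (simp only: complex_norm_square[symmetric] cinner_self power_mult_distrib of_real_mult)
  finally have "(norm (c *\<^sub>C x))\<^sup>2 = (norm c * norm x)\<^sup>2" by (simp only: of_real_eq_iff)
  then show ?thesis by (rule power2_eq_imp_eq) simp_all
qed

lemma cinner_extensionality:
  assumes "\<And>g. cinner x g = cinner y g"
  shows "x = y"
proof -
  have "inner x (x - y) = inner y (x - y)"
    using assms[of "x - y"] by (simp only: inner_eq_Re_cinner)
  then have "inner (x - y) (x - y) = 0" by (simp add: inner_diff_left)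
  then show ?thesis by simp
qed

text \<open>
  Multiplying \<open>x\<close> by the conjugate of \<open>cinner x y\<close> makes the inner product with \<open>y\<close> real and
  nonnegative, which reduces the claim to the real Cauchy-Schwarz inequality.
\<close>
lemma norm_cinner_le: "norm (cinner x y) \<le> norm x * norm (y::'a::complex_inner)"
proof -
  define z where "z = cinner x y"
  have "norm z * norm z = Re (cinner (cnj z *\<^sub>C x) y)"
    by (simp add: cinner_scaleC_left flip: z_def)
      (simp add: cmod_power2 flip: power2_eq_square)
  also have "\<dots> \<le> norm (cnj z *\<^sub>C x) * norm y"
    using norm_cauchy_schwarz by (simp add: inner_eq_Re_cinner[symmetric])
  finally have "norm z * norm z \<le> norm z * (norm x * norm y)"
    by (simp add: norm_scaleC mult.assoc)
  then show ?thesis unfolding z_def[symmetric] by (cases "z = 0") auto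
qed

section \<open>Sesquilinear forms and operators\<close>

locale bounded_sesquilinear =
  fixes b :: "'a::complex_inner \<Rightarrow> 'a \<Rightarrow> complex"
  assumes add_left: "b (x + y) z = b x z + b y z"
    and add_right: "b x (y + z) = b x y + b x z"
    and scale_left: "b (c *\<^sub>C x) y = c * b x y"
    and scale_right: "b x (c *\<^sub>C y) = cnj c * b x y"
    and bounded: "\<exists>K. \<forall>x y. norm (b x y) \<le> K * norm x * norm y"

text \<open>
  An estimate of \<open>b x y\<close> by a sum such as \<open>B * (norm x)\<^sup>2 + D * (norm y)\<^sup>2\<close> does not have the
  product form required for boundedness, but by homogeneity its value on unit vectors is enough.
\<close>
lemma bounded_sesquilinearI_unit:
  fixes b :: "'a::complex_inner \<Rightarrow> 'a \<Rightarrow> complex"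
  assumes add_left: "\<And>x y z. b (x + y) z = b x z + b y z"
    and add_right: "\<And>x y z. b x (y + z) = b x y + b x z"
    and scale_left: "\<And>c x y. b (c *\<^sub>C x) y = c * b x y"
    and scale_right: "\<And>c x y. b x (c *\<^sub>C y) = cnj c * b x y"
    and unit: "\<And>x y. norm x = 1 \<Longrightarrow> norm y = 1 \<Longrightarrow> norm (b x y) \<le> K"
  shows "bounded_sesquilinear b"
proof
  have "norm (b x y) \<le> K * norm x * norm y" for x y
  proof (cases "x = 0 \<or> y = 0")
    case True
    then have "b x y = 0" using add_left[of 0 0 y] add_right[of x 0 0] by auto
    with True show ?thesis by auto
  next
    case False
    then have "norm (b ((1 / norm x) *\<^sub>R x) ((1 / norm y) *\<^sub>R y)) \<le> K"
      by (intro unit) simp_all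
    then have "norm (b x y) / (norm x * norm y) \<le> K"
      by (simp add: scaleR_eq_scaleC scale_left scale_right norm_mult norm_divide mult.commute)
    with False show ?thesis by (simp add: divide_le_eq mult.assoc)
  qed
  then show "\<exists>K. \<forall>x y. norm (b x y) \<le> K * norm x * norm y" by blast
qed (fact add_left add_right scale_left scale_right)+

text \<open>
  The real Riesz theorem represents \<open>\<lambda>y. Re (b x y)\<close> by a vector \<open>T x\<close>. The imaginary parts then
  agree as well, because replacing \<open>y\<close> by \<open>\<i> *\<^sub>C y\<close> turns the imaginary part of either side into a
  real part. Linearity of \<open>T\<close> follows from uniqueness of the representing vector.
\<close>
theorem sesquilinear_operator:
  fixes b :: "'a::chilbert_space \<Rightarrow> 'a \<Rightarrow> complex"
  assumes "bounded_sesquilinear b"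
  shows "\<exists>!T. bounded_clinear T \<and> (\<forall>x y. cinner (T x) y = b x y)"
proof -
  interpret bounded_sesquilinear b by fact
  obtain K' where K': "\<And>x y. norm (b x y) \<le> K' * norm x * norm y" using bounded by blast
  define K where "K = \<bar>K'\<bar>"
  have K: "norm (b x y) \<le> K * norm x * norm y" for x y
    using K'[of x y] unfolding K_def
    by (rule order_trans) (intro mult_right_mono, auto)
  have "\<exists>z. \<forall>y. cinner z y = b x y" for x
  proof -
    have "bounded_linear (\<lambda>y. Re (b x y))"
    proof (rule bounded_linear_intro)
      show "Re (b x (r *\<^sub>R y)) = r *\<^sub>R Re (b x y)" for r y
        by (simp add: scaleR_eq_scaleC scale_right)
      show "norm (Re (b x y)) \<le> norm y * (K * norm x)" for y
        using abs_Re_le_cmod[of "b x y"] K[of x y] by (simp add: mult.commute)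
    qed (simp add: add_right)
    then obtain z where z: "\<And>y. Re (b x y) = inner z y" using riesz_real by blast
    have "cinner z y = b x y" for y
    proof (rule complex_eqI)
      show "Re (cinner z y) = Re (b x y)" by (simp add: z inner_eq_Re_cinner)
      show "Im (cinner z y) = Im (b x y)"
        using z[of "\<i> *\<^sub>C y"] by (simp add: inner_eq_Re_cinner scale_right cinner_scaleC_right)
    qed
    then show ?thesis by blast
  qed
  then obtain T where T: "\<And>x y. cinner (T x) y = b x y" by metis
  have scale: "T (c *\<^sub>C x) = c *\<^sub>C T x" for c x
    by (rule cinner_extensionality) (simp add: T scale_left cinner_scaleC_left)
  have "bounded_linear T"
  proof (rule bounded_linear_intro)
    show "T (x + y) = T x + T y" for x y
      by (rule cinner_extensionality) (simp add: T add_left cinner_add_left)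
    show "T (r *\<^sub>R x) = r *\<^sub>R T x" for r x
      by (simp add: scaleR_eq_scaleC scale)
    show "norm (T x) \<le> norm x * K" for x
    proof (cases "T x = 0")
      case True
      then show ?thesis by (simp add: K_def)
    next
      case False
      have "norm (T x) * norm (T x) = norm (b x (T x))"
        by (simp add: T[symmetric] cinner_self norm_power power2_eq_square norm_mult)
      also have "\<dots> \<le> (norm x * K) * norm (T x)" using K[of x "T x"] by (simp add: mult.commute)
      finally show ?thesis using False by simp
    qed
  qed
  show ?thesis
  proof (rule ex1I[of _ T])
    show "bounded_clinear T \<and> (\<forall>x y. cinner (T x) y = b x y)"
      using \<open>bounded_linear T\<close> scale T by (simp add: bounded_clinear_def)
  next
    fix S assume S: "bounded_clinear S \<and> (\<forall>x y. cinner (S x) y = b x y)"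
    show "S = T" by (rule ext, rule cinner_extensionality) (simp add: S T)
  qed
qed

text \<open>
  The adjoint is the operator of the form \<open>\<lambda>y x. cinner y (T x)\<close>, which has the arguments in this
  order so that it is linear in the first one.
\<close>
lemma cinner_cadjoint:
  assumes "bounded_clinear T"
  shows "cinner x (cadjoint T y) = cinner (T x) y"
proof -
  have bl: "bounded_linear T" and sc: "\<And>c x. T (c *\<^sub>C x) = c *\<^sub>C T x"
    using assms by (auto simp: bounded_clinear_def)
  obtain K where K: "\<And>x. norm (T x) \<le> norm x * K" using bounded_linear.bounded[OF bl] by blast
  have "bounded_sesquilinear (\<lambda>y x. cinner y (T x))"
  proof
    have "norm (cinner y (T x)) \<le> K * norm y * norm x" for x y
    proof -
      have "norm (cinner y (T x)) \<le> norm y * norm (T x)" by (rule norm_cinner_le)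
      also have "\<dots> \<le> norm y * (norm x * K)" by (intro mult_left_mono K) simp
      finally show ?thesis by (simp add: ac_simps)
    qed
    then show "\<exists>K. \<forall>y x. norm (cinner y (T x)) \<le> K * norm y * norm x" by blast
  qed (simp_all add: cinner_add_left cinner_add_right cinner_scaleC_left cinner_scaleC_right sc
      linear_add bl bounded_linear.linear)
  from sesquilinear_operator[OF this]
  have "\<exists>!S. bounded_clinear S \<and> (\<forall>x y. cinner (T x) y = cinner x (S y))"
    by (metis cinner_commute)
  from conjunct2[OF theI'[OF this], rule_format, symmetric] show ?thesis
    unfolding cadjoint_def .
qed

section \<open>The multiplier as a bounded form\<close>

text \<open>
  For a pair with equal components the biframe integrand is a squared absolute value, so the Bessel
  condition is the usual square integrability of the coefficients.
\<close>
lemma bessel_square_integrable: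
  assumes "continuous_biframe_bessel \<mu> F F"
  obtains B where "B > 0"
    and "\<And>f. integrable \<mu> (\<lambda>w. (norm (cinner f (F w)))\<^sup>2)"
    and "\<And>f. (LINT w|\<mu>. (norm (cinner f (F w)))\<^sup>2) \<le> B * (norm f)\<^sup>2"
proof -
  have eq: "cinner f (F w) * cinner (F w) f = complex_of_real ((norm (cinner f (F w)))\<^sup>2)" for f w
    using complex_norm_square[of "cinner f (F w)"] cinner_commute[of "F w" f] by simp
  obtain B where B: "B > 0"
    and bessel: "\<forall>f. integrable \<mu> (\<lambda>w. cinner f (F w) * cinner (F w) f) \<and>
      (LINT w|\<mu>. cinner f (F w) * cinner (F w) f) \<in> \<real> \<and>
      Re (LINT w|\<mu>. cinner f (F w) * cinner (F w) f) \<le> B * (norm f)\<^sup>2"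
    using assms unfolding continuous_biframe_bessel_def by blast
  show ?thesis
  proof (rule that[OF B])
    show "integrable \<mu> (\<lambda>w. (norm (cinner f (F w)))\<^sup>2)" for f
      using integrable_Re[OF conjunct1[OF spec[OF bessel, of f]]] by (simp only: eq Re_complex_of_real)
    show "(LINT w|\<mu>. (norm (cinner f (F w)))\<^sup>2) \<le> B * (norm f)\<^sup>2" for f
      using spec[OF bessel, of f] by (simp only: eq integral_complex_of_real Re_complex_of_real)
  qed
qed

text \<open>
  If \<open>norm (m w) \<le> \<bar>C\<bar>\<close>, the inequality \<open>a * d \<le> a\<^sup>2 + d\<^sup>2\<close> for the absolute values of the
  coefficients of \<open>f\<close> and \<open>g\<close> dominates the integrand by an integrable function. This gives both
  integrability and an estimate of the form on unit vectors.
\<close>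
lemma multiplier_form:
  fixes F G :: "'w \<Rightarrow> 'h::chilbert_space"
  assumes F: "continuous_biframe_bessel \<mu> F F" and G: "continuous_biframe_bessel \<mu> G G"
    and m: "m \<in> borel_measurable \<mu>" "essentially_bounded \<mu> m"
  shows integrable_multiplier: "integrable \<mu> (\<lambda>w. m w * cinner f (F w) * cinner (G w) g)"
    and bounded_sesquilinear_multiplier:
      "bounded_sesquilinear (\<lambda>f g. LINT w|\<mu>. m w * cinner f (F w) * cinner (G w) g)"
proof -
  obtain B where B: "B > 0" "\<And>f. integrable \<mu> (\<lambda>w. (norm (cinner f (F w)))\<^sup>2)"
    "\<And>f. (LINT w|\<mu>. (norm (cinner f (F w)))\<^sup>2) \<le> B * (norm f)\<^sup>2"
    using bessel_square_integrable[OF F] by blast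
  obtain D where D: "D > 0" "\<And>f. integrable \<mu> (\<lambda>w. (norm (cinner f (G w)))\<^sup>2)"
    "\<And>f. (LINT w|\<mu>. (norm (cinner f (G w)))\<^sup>2) \<le> D * (norm f)\<^sup>2"
    using bessel_square_integrable[OF G] by blast
  obtain C where "AE w in \<mu>. norm (m w) \<le> C" using m(2) by (auto simp: essentially_bounded_def)
  then have C: "AE w in \<mu>. norm (m w) \<le> \<bar>C\<bar>" by eventually_elim linarith
  let ?I = "\<lambda>f g w. m w * cinner f (F w) * cinner (G w) g"
  let ?R = "\<lambda>f g w. \<bar>C\<bar> * ((norm (cinner f (F w)))\<^sup>2 + (norm (cinner g (G w)))\<^sup>2)"
  have [measurable]: "(\<lambda>w. cinner f (F w)) \<in> borel_measurable \<mu>" for f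
    using F by (simp add: continuous_biframe_bessel_def weakly_measurable_map_def)
  have [measurable]: "(\<lambda>w. cinner (G w) f) \<in> borel_measurable \<mu>" for f
  proof -
    have "(\<lambda>w. cinner f (G w)) \<in> borel_measurable \<mu>"
      using G by (simp add: continuous_biframe_bessel_def weakly_measurable_map_def)
    then have "(\<lambda>w. cnj (cinner f (G w))) \<in> borel_measurable \<mu>"
      by (rule borel_measurable_continuous_on[rotated]) (intro continuous_intros)
    then show ?thesis by (simp flip: cinner_commute)
  qed
  note [measurable] = m(1)
  have R: "integrable \<mu> (?R f g)" for f g
    using B(2) D(2) by simp
  have le: "AE w in \<mu>. norm (?I f g w) \<le> ?R f g w" for f g
    using C
  proof eventually_elim
    case (elim w)
    define a where "a = norm (cinner f (F w))"
    define d where "d = norm (cinner g (G w))"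
    have "norm (cinner (G w) g) = d"
      unfolding d_def by (metis cinner_commute complex_mod_cnj)
    then have "norm (?I f g w) = norm (m w) * (a * d)" by (simp add: norm_mult a_def)
    also have "\<dots> \<le> \<bar>C\<bar> * (a * d)" using elim by (intro mult_right_mono) (auto simp: a_def d_def)
    also have "\<dots> \<le> \<bar>C\<bar> * (a\<^sup>2 + d\<^sup>2)"
    proof (intro mult_left_mono)
      have "0 \<le> a * d" by (simp add: a_def d_def)
      then show "a * d \<le> a\<^sup>2 + d\<^sup>2" using sum_squares_bound[of a d] by linarith
    qed simp
    finally show ?case by (simp add: a_def d_def)
  qed
  show I: "integrable \<mu> (?I f g)" for f g
    by (rule Bochner_Integration.integrable_bound[OF R[of f g]])
      (use le[of f g] in \<open>measurable, auto elim: eventually_mono\<close>)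
  have raw: "norm (LINT w|\<mu>. ?I f g w) \<le> \<bar>C\<bar> * (B * (norm f)\<^sup>2 + D * (norm g)\<^sup>2)" for f g
  proof -
    have "norm (LINT w|\<mu>. ?I f g w) \<le> (LINT w|\<mu>. ?R f g w)"
      by (rule order_trans[OF integral_norm_bound
            integral_mono_AE[OF integrable_norm[OF I] R le]])
    also have "\<dots> = \<bar>C\<bar> * ((LINT w|\<mu>. (norm (cinner f (F w)))\<^sup>2) + (LINT w|\<mu>. (norm (cinner g (G w)))\<^sup>2))"
      using B(2) D(2) by simp
    also have "\<dots> \<le> \<bar>C\<bar> * (B * (norm f)\<^sup>2 + D * (norm g)\<^sup>2)"
      by (intro mult_left_mono add_mono B D) simp
    finally show ?thesis .
  qed
  show "bounded_sesquilinear (\<lambda>f g. LINT w|\<mu>. ?I f g w)"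
  proof (rule bounded_sesquilinearI_unit)
    show "(LINT w|\<mu>. ?I (x + y) z w) = (LINT w|\<mu>. ?I x z w) + (LINT w|\<mu>. ?I y z w)" for x y z
      by (simp add: cinner_add_left distrib_left distrib_right I Bochner_Integration.integral_add)
    show "(LINT w|\<mu>. ?I x (y + z) w) = (LINT w|\<mu>. ?I x y w) + (LINT w|\<mu>. ?I x z w)" for x y z
      by (simp add: cinner_add_right distrib_left I Bochner_Integration.integral_add)
    show "(LINT w|\<mu>. ?I (c *\<^sub>C x) y w) = c * (LINT w|\<mu>. ?I x y w)" for c x y
      by (simp add: cinner_scaleC_left ac_simps flip: integral_mult_right_zero)
    show "(LINT w|\<mu>. ?I x (c *\<^sub>C y) w) = cnj c * (LINT w|\<mu>. ?I x y w)" for c x y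
      by (simp add: cinner_scaleC_right ac_simps flip: integral_mult_right_zero)
    show "norm (LINT w|\<mu>. ?I x y w) \<le> \<bar>C\<bar> * (B + D)" if "norm x = 1" "norm y = 1" for x y
      using raw[of x y] that by simp
  qed
qed

section \<open>The dual biframe\<close>

theorem theorem3p19:
  fixes \<mu> :: "'w measure"
    and F G :: "'w \<Rightarrow> 'h::chilbert_space"
    and m :: "'w \<Rightarrow> complex"
  assumes "continuous_biframe_bessel \<mu> F F"
    and "continuous_biframe_bessel \<mu> G G"
    and "m \<in> borel_measurable \<mu>"
    and "essentially_bounded \<mu> m"
    and "invertible_operator (biframe_bessel_multiplier \<mu> m F G)"
    and "continuous_biframe \<mu> F G"
  shows "dual_continuous_biframe \<mu>
           (\<lambda>w. cadjoint (inv (biframe_bessel_multiplier \<mu> m F G)) (cnj (m w) *\<^sub>C F w)) G"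
proof -
  define M where "M = biframe_bessel_multiplier \<mu> m F G"
  have M: "cinner (M f) g = (LINT w|\<mu>. m w * cinner f (F w) * cinner (G w) g)" for f g
    using theI'[OF sesquilinear_operator[OF bounded_sesquilinear_multiplier[OF assms(1-4)]]]
    unfolding M_def biframe_bessel_multiplier_def by simp
  obtain S where S: "bounded_clinear S" "S \<circ> M = id" "M \<circ> S = id"
    using assms(5) unfolding M_def invertible_operator_def by blast
  have inv_M: "inv M = S" using S(2,3) by (rule inv_unique_comp[rotated])
  have MS: "M (S f) = f" for f using S(3) by (metis comp_apply id_apply)
  define \<Phi> where "\<Phi> w = cadjoint S (cnj (m w) *\<^sub>C F w)" for w
  \<comment> \<open>the coefficients of \<open>f\<close> with respect to \<open>\<Phi>\<close> are the weighted coefficients of \<open>S f\<close>\<close>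
  have analysis: "cinner f (\<Phi> w) = m w * cinner (S f) (F w)" for f w
    unfolding \<Phi>_def by (simp add: cinner_cadjoint[OF S(1)] cinner_scaleC_right)
  have repr: "has_bochner_integral \<mu> (\<lambda>w. cinner f (\<Phi> w) * cinner (G w) g) (cinner f g)" for f g
    using integrable_multiplier[OF assms(1-4), of "S f" g] M[of "S f" g]
    by (simp add: has_bochner_integral_iff analysis MS)
  have "weakly_measurable_map \<mu> \<Phi>"
  proof -
    have "(\<lambda>w. cinner (S f) (F w)) \<in> borel_measurable \<mu>" for f
      using assms(1) by (simp add: continuous_biframe_bessel_def weakly_measurable_map_def)
    then show ?thesis
      using assms(3) by (auto simp: weakly_measurable_map_def analysis)
  qed
  moreover have "weakly_measurable_map \<mu> G"
    using assms(2) by (simp add: continuous_biframe_bessel_def)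
  moreover have "integrable \<mu> (\<lambda>w. cinner f (\<Phi> w) * cinner (G w) f)"
    and "(LINT w|\<mu>. cinner f (\<Phi> w) * cinner (G w) f) = complex_of_real ((norm f)\<^sup>2)" for f
    using repr[of f f] by (simp_all add: has_bochner_integral_iff cinner_self)
  ultimately have "continuous_biframe \<mu> \<Phi> G"
    unfolding continuous_biframe_def by (auto intro!: exI[of _ "1::real"])
  with repr show ?thesis
    unfolding dual_continuous_biframe_def M_def[symmetric] inv_M \<Phi>_def by blast
qed

end
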